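(* Let $D$ be an integral domain with field of fractions $K$, and let $E\subseteq D$ be a finite non-empty subset. Then the ring of integer-valued polynomials $\operatorname{Int}(E,D)=\{g\in K[X]\mid g(E)\subseteq D\}$ is a finite conductor ring if and only if $D$ is a finite conductor ring; and $\operatorname{Int}(E,D)$ is coherent if and only if $D$ is coherent.
   Context: All rings are commutative with identity. A ring is a finite conductor ring if every ideal of it that can be generated by two elements is finitely presented. A ring is coherent if every finitely generated ideal of it is finitely presented. *)

theory Defs
  imports "HOL-Algebra.Algebraic_Closure_Type"
begin

(* An R-linear map out of the free module R^n is given by the images a 0, ..., a (n - 1) of the
   standard basis vectors. Vectors of R^n are extensional functions on {..<n}. *)

definition lin_comb :: "('a, 'b) ring_scheme \<Rightarrow> nat \<Rightarrow> (nat \<Rightarrow> 'a) \<Rightarrow> (nat \<Rightarrow> 'a) \<Rightarrow> 'a" where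
  "lin_comb R n a r = (\<Oplus>\<^bsub>R\<^esub>i\<in>{..<n}. r i \<otimes>\<^bsub>R\<^esub> a i)"

definition relations :: "('a, 'b) ring_scheme \<Rightarrow> nat \<Rightarrow> (nat \<Rightarrow> 'a) \<Rightarrow> (nat \<Rightarrow> 'a) set" where
  "relations R n a = {r \<in> {..<n} \<rightarrow>\<^sub>E carrier R. lin_comb R n a r = \<zero>\<^bsub>R\<^esub>}"

(* Exactness of R^m \<rightarrow> R^n \<rightarrow> I \<rightarrow> 0, where the second map sends the i-th basis vector
   to a i in I and the first one sends the j-th basis vector to s j in R^n. *)

definition finitely_presented_ideal :: "('a, 'b) ring_scheme \<Rightarrow> 'a set \<Rightarrow> bool" where
  "finitely_presented_ideal R I \<longleftrightarrow>
     ideal I R \<and>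
     (\<exists>n m. \<exists>a \<in> {..<n} \<rightarrow> I. \<exists>s \<in> {..<m} \<rightarrow> ({..<n} \<rightarrow>\<^sub>E carrier R).
        lin_comb R n a ` ({..<n} \<rightarrow>\<^sub>E carrier R) = I \<and>
        (\<lambda>c. \<lambda>i\<in>{..<n}. lin_comb R m (\<lambda>j. s j i) c) ` ({..<m} \<rightarrow>\<^sub>E carrier R) = relations R n a)"

definition finite_conductor_ring :: "('a, 'b) ring_scheme \<Rightarrow> bool" where
  "finite_conductor_ring R \<longleftrightarrow>
     cring R \<and> (\<forall>a \<in> carrier R. \<forall>b \<in> carrier R. finitely_presented_ideal R (Idl\<^bsub>R\<^esub> {a, b}))"

definition coherent_ring :: "('a, 'b) ring_scheme \<Rightarrow> bool" where
  "coherent_ring R \<longleftrightarrow>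
     cring R \<and>
     (\<forall>S. finite S \<and> S \<subseteq> carrier R \<longrightarrow> finitely_presented_ideal R (Idl\<^bsub>R\<^esub> S))"

(* The domain D is the type 'a and its field of fractions K is 'a fract, in which D is embedded by
   to_fract. *)

definition int_valued_polys :: "'a::idom set \<Rightarrow> 'a fract poly set" where
  "int_valued_polys E = {g. \<forall>e\<in>E. poly g (to_fract e) \<in> range to_fract}"

definition int_valued_ring :: "'a::idom set \<Rightarrow> 'a fract poly ring" where
  "int_valued_ring E = ring_of_type_algebra\<lparr>carrier := int_valued_polys E\<rparr>"

lemma range_to_fract_closed:
  fixes x y :: "'a::idom fract"
  shows "x \<in> range to_fract \<Longrightarrow> y \<in> range to_fract \<Longrightarrow> x + y \<in> range to_fract"
    "x \<in> range to_fract \<Longrightarrow> y \<in> range to_fract \<Longrightarrow> x * y \<in> range to_fract"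
    "x \<in> range to_fract \<Longrightarrow> - x \<in> range to_fract"
  by (auto simp flip: to_fract_add to_fract_mult to_fract_uminus)

lemma cring_int_valued_ring: "cring (int_valued_ring E)"
proof -
  let ?P = "ring_of_type_algebra :: 'a fract poly ring"
  interpret P: cring ?P by (rule cring_from_type_algebra)
  have neg: "\<ominus>\<^bsub>?P\<^esub> g = - g" for g
    by (rule P.minus_equality) (auto simp: ring_of_type_algebra_def)
  have "subring (int_valued_polys E) ?P"
  proof (rule P.subringI)
    show "int_valued_polys E \<subseteq> carrier ?P"
      by (simp add: ring_of_type_algebra_def)
    show "\<one>\<^bsub>?P\<^esub> \<in> int_valued_polys E"
      by (auto simp: int_valued_polys_def ring_of_type_algebra_def intro!: range_eqI[where x = 1])
    show "\<ominus>\<^bsub>?P\<^esub> h \<in> int_valued_polys E" if "h \<in> int_valued_polys E" for h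
      using that unfolding neg by (simp add: int_valued_polys_def range_to_fract_closed)
  qed (simp_all add: int_valued_polys_def ring_of_type_algebra_def range_to_fract_closed)
  then have "subcring (int_valued_polys E) ?P"
    by (rule P.subcringI')
  then show ?thesis
    unfolding int_valued_ring_def using P.subcring_iff[of "int_valued_polys E"]
    by (auto simp: ring_of_type_algebra_def)
qed

end

theory Submission
  imports Defs
begin

text \<open>A finitely generated ideal is finitely presented exactly when the relations of one,
  equivalently every, finite generating tuple form a finitely generated module. One implication is
  read off the presentation; the other is Schanuel's lemma,
  \<open>fg_relations_if_finitely_presented_ideal\<close>. Hence both properties say that relation
  modules of n-tuples are finitely generated, with n = 2 for finite conductor rings and all n for
  coherent ones. It remains to compare D with B = Int(E,D) for each fixed n.

  From B to D (\<open>fg_relations_UNIV_if_int_valued_polys\<close>): constants embed D into B, and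
  evaluation at a point of E maps B back onto D. Evaluating generating relations of a constant tuple
  gives generating relations over D.

  From D to B (\<open>fg_relations_int_valued_polys\<close>): put f = \<Prod>e\<in>E. X - e. Every
  multiple of f in K[X] vanishes on E and so lies in B; modulo these multiples an element of B is
  known from its finitely many values in D. Accordingly, a relation over B splits in two. Its values
  at each point of E form a relation over D, governed by finitely many generators that lift to B.
  What remains is f times a relation over the principal ideal domain K[X]; there relations have
  finitely many generators, and their denominators are absorbed by coefficients divisible by
  f.\<close>

section \<open>Finite generation of relation modules\<close>

text \<open>Vectors are arbitrary functions of which only the entries below \<open>n\<close> count,
  in contrast to the extensional ones in \<open>relations\<close>. The ring is a subset
  \<open>C\<close> of a type, so that one notion serves D and the integer-valued
  polynomials.\<close>

definition fg_relations :: "'b::comm_ring_1 set \<Rightarrow> nat \<Rightarrow> (nat \<Rightarrow> 'b) \<Rightarrow> bool" where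
  "fg_relations C n a \<longleftrightarrow>
     (\<exists>(m::nat) s. (\<forall>j<m. (\<forall>i<n. s j i \<in> C) \<and> (\<Sum>i<n. s j i * a i) = 0) \<and>
        (\<forall>r. (\<forall>i<n. r i \<in> C) \<and> (\<Sum>i<n. r i * a i) = 0 \<longrightarrow>
           (\<exists>c. (\<forall>j<m. c j \<in> C) \<and> (\<forall>i<n. r i = (\<Sum>j<m. c j * s j i)))))"

text \<open>Generators may be indexed by any finite set, because they arise below as disjoint unions
  of two families.\<close>

lemma fg_relationsI:
  fixes C :: "'b::comm_ring_1 set"
  assumes "finite J"
    and "\<And>j i. j \<in> J \<Longrightarrow> i < n \<Longrightarrow> s j i \<in> C"
    and "\<And>j. j \<in> J \<Longrightarrow> (\<Sum>i<n. s j i * a i) = 0"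
    and "\<And>r. (\<And>i. i < n \<Longrightarrow> r i \<in> C) \<Longrightarrow> (\<Sum>i<n. r i * a i) = 0 \<Longrightarrow>
           \<exists>c. (\<forall>j\<in>J. c j \<in> C) \<and> (\<forall>i<n. r i = (\<Sum>j\<in>J. c j * s j i))"
  shows "fg_relations C n a"
proof -
  obtain h where h: "bij_betw h {..<card J} J"
    using ex_bij_betw_nat_finite[OF assms(1)] by (auto simp: atLeast0LessThan)
  then have hJ: "h j \<in> J" if "j < card J" for j
    using that by (auto simp: bij_betw_def)
  show ?thesis
    unfolding fg_relations_def
  proof (intro exI[of _ "card J"] exI[of _ "\<lambda>j. s (h j)"] conjI allI impI)
    fix r assume "(\<forall>i<n. r i \<in> C) \<and> (\<Sum>i<n. r i * a i) = 0"
    then obtain c where c: "\<forall>j\<in>J. c j \<in> C" "\<forall>i<n. r i = (\<Sum>j\<in>J. c j * s j i)"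
      using assms(4)[of r] by blast
    have "(\<Sum>j\<in>J. c j * s j i) = (\<Sum>j<card J. c (h j) * s (h j) i)" for i
      by (rule sum.reindex_bij_betw[OF h, symmetric])
    with c show "\<exists>c. (\<forall>j<card J. c j \<in> C) \<and> (\<forall>i<n. r i = (\<Sum>j<card J. c j * s (h j) i))"
      by (intro exI[of _ "c \<circ> h"]) (simp add: hJ)
  qed (simp_all add: assms hJ)
qed

lemma fg_relationsE:
  fixes C :: "'b::comm_ring_1 set"
  assumes "fg_relations C n a"
  obtains m :: nat and s where
    "\<forall>j<m. \<forall>i<n. s j i \<in> C"
    "\<forall>j<m. (\<Sum>i<n. s j i * a i) = 0"
    "\<forall>r. (\<forall>i<n. r i \<in> C) \<longrightarrow> (\<Sum>i<n. r i * a i) = 0 \<longrightarrow>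
       (\<exists>c. (\<forall>j<m. c j \<in> C) \<and> (\<forall>i<n. r i = (\<Sum>j<m. c j * s j i)))"
proof -
  from assms obtain m :: nat and s where
    1: "\<forall>j<m. (\<forall>i<n. s j i \<in> C) \<and> (\<Sum>i<n. s j i * a i) = 0" and
    2: "\<forall>r. (\<forall>i<n. r i \<in> C) \<and> (\<Sum>i<n. r i * a i) = 0 \<longrightarrow>
           (\<exists>c. (\<forall>j<m. c j \<in> C) \<and> (\<forall>i<n. r i = (\<Sum>j<m. c j * s j i)))"
    unfolding fg_relations_def by (elim exE conjE)
  show thesis
    by (rule that[of m s]) (use 1 2 in blast)+
qed

section \<open>Subrings of a type as ring structures\<close>

lemma ring_of_type_algebra_simps [simp]:
  "carrier ring_of_type_algebra = UNIV"
  "\<zero>\<^bsub>ring_of_type_algebra\<^esub> = 0" "\<one>\<^bsub>ring_of_type_algebra\<^esub> = 1"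
  "x \<oplus>\<^bsub>ring_of_type_algebra\<^esub> y = x + y" "x \<otimes>\<^bsub>ring_of_type_algebra\<^esub> y = x * y"
  by (simp_all add: ring_of_type_algebra_def)

text \<open>Instantiated with \<open>UNIV\<close> for D and with \<open>int_valued_polys E\<close>
  inside K[X], so that ring-record operations turn into ordinary sums and products.\<close>

locale type_subring =
  fixes C :: "'b::comm_ring_1 set"
  assumes one_mem: "1 \<in> C"
    and uminus_mem: "x \<in> C \<Longrightarrow> - x \<in> C"
    and add_mem: "x \<in> C \<Longrightarrow> y \<in> C \<Longrightarrow> x + y \<in> C"
    and mult_mem: "x \<in> C \<Longrightarrow> y \<in> C \<Longrightarrow> x * y \<in> C"
begin

lemma zero_mem: "0 \<in> C"
  using add_mem[OF one_mem uminus_mem[OF one_mem]] by simp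

lemma diff_mem: "x \<in> C \<Longrightarrow> y \<in> C \<Longrightarrow> x - y \<in> C"
  using add_mem[of x "- y"] uminus_mem[of y] by simp

lemma sum_mem: "(\<And>i. i \<in> A \<Longrightarrow> f i \<in> C) \<Longrightarrow> (\<Sum>i\<in>A. f i) \<in> C"
  by (induction A rule: infinite_finite_induct) (auto simp: zero_mem add_mem)

abbreviation ring_of :: "'b ring" where
  "ring_of \<equiv> ring_of_type_algebra\<lparr>carrier := C\<rparr>"

lemma ring_of_simps [simp]:
  "carrier ring_of = C" "\<zero>\<^bsub>ring_of\<^esub> = 0" "\<one>\<^bsub>ring_of\<^esub> = 1"
  "x \<oplus>\<^bsub>ring_of\<^esub> y = x + y" "x \<otimes>\<^bsub>ring_of\<^esub> y = x * y"
  by simp_all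

sublocale R: cring ring_of
proof unfold_locales
  show "carrier (add_monoid ring_of) \<subseteq> Units (add_monoid ring_of)"
    unfolding Units_def
    by (auto simp: add_mem intro!: bexI[of _ "- _"] uminus_mem)
qed (auto simp: add_mem mult_mem one_mem zero_mem algebra_simps)

lemma a_inv_ring_of [simp]: "x \<in> C \<Longrightarrow> \<ominus>\<^bsub>ring_of\<^esub> x = - x"
  by (rule R.minus_equality) (simp_all add: uminus_mem)

lemma finsum_ring_of: "finite A \<Longrightarrow> (\<And>i. i \<in> A \<Longrightarrow> f i \<in> C) \<Longrightarrow> finsum ring_of f A = (\<Sum>i\<in>A. f i)"
proof (induction A rule: finite_induct)
  case (insert x F)
  then have "finsum ring_of f (insert x F) = f x \<oplus>\<^bsub>ring_of\<^esub> finsum ring_of f F"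
    by (intro R.finsum_insert) auto
  with insert show ?case by simp
qed simp

lemma lin_comb_ring_of:
  assumes "\<And>i. i < n \<Longrightarrow> a i \<in> C" "\<And>i. i < n \<Longrightarrow> r i \<in> C"
  shows "lin_comb ring_of n a r = (\<Sum>i<n. r i * a i)"
  unfolding lin_comb_def using assms by (subst finsum_ring_of) (auto simp: mult_mem)

section \<open>Finitely presented ideals in terms of relations\<close>

lemma genideal_image:
  fixes n :: nat
  assumes a: "\<And>i. i < n \<Longrightarrow> a i \<in> C"
  shows "Idl\<^bsub>ring_of\<^esub> (a ` {..<n}) = {\<Sum>i<n. r i * a i |r. \<forall>i<n. r i \<in> C}" (is "_ = ?I")
proof
  have mem: "(\<Sum>i<n. r i * a i) \<in> ?I" if "\<forall>i<n. r i \<in> C" for r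
    using that by blast
  have "ideal ?I ring_of"
  proof (rule idealI)
    show "ring ring_of" by (rule R.ring_axioms)
    show "subgroup ?I (add_monoid ring_of)"
    proof
      show "?I \<subseteq> carrier (add_monoid ring_of)"
        using a by (auto intro!: sum_mem mult_mem)
      show "\<one>\<^bsub>add_monoid ring_of\<^esub> \<in> ?I"
        using mem[of "\<lambda>_. 0"] by (simp add: zero_mem)
      show "x \<otimes>\<^bsub>add_monoid ring_of\<^esub> y \<in> ?I" if xy: "x \<in> ?I" "y \<in> ?I" for x y
      proof -
        from xy obtain r s where rs: "\<forall>i<n. r i \<in> C" "x = (\<Sum>i<n. r i * a i)"
          "\<forall>i<n. s i \<in> C" "y = (\<Sum>i<n. s i * a i)" by blast
        then show ?thesis
          using mem[of "\<lambda>i. r i + s i"] by (simp add: add_mem distrib_right sum.distrib)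
      qed
      show "inv\<^bsub>add_monoid ring_of\<^esub> x \<in> ?I" if x: "x \<in> ?I" for x
      proof -
        from x obtain r where r: "\<forall>i<n. r i \<in> C" "x = (\<Sum>i<n. r i * a i)" by blast
        then have "x \<in> C" using a by (auto intro!: sum_mem mult_mem)
        then have "inv\<^bsub>add_monoid ring_of\<^esub> x = - x"
          using a_inv_ring_of by (simp add: a_inv_def)
        with r show ?thesis
          using mem[of "\<lambda>i. - r i"] by (simp add: uminus_mem sum_negf)
      qed
    qed
    show l: "x \<otimes>\<^bsub>ring_of\<^esub> y \<in> ?I" if y: "y \<in> ?I" and x: "x \<in> carrier ring_of" for x y
    proof -
      from y obtain r where r: "\<forall>i<n. r i \<in> C" "y = (\<Sum>i<n. r i * a i)" by blast
      with x show ?thesis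
        using mem[of "\<lambda>i. x * r i"] by (simp add: mult_mem sum_distrib_left mult.assoc)
    qed
    show "y \<otimes>\<^bsub>ring_of\<^esub> x \<in> ?I" if "y \<in> ?I" and "x \<in> carrier ring_of" for x y
      using l[OF that] by (simp only: ring_of_simps mult.commute)
  qed
  moreover have "a ` {..<n} \<subseteq> ?I"
  proof (rule image_subsetI)
    fix i assume "i \<in> {..<n}"
    then have i: "i < n" by simp
    have "(\<Sum>k<n. (if k = i then 1 else 0) * a k) = a i"
      using i by (simp add: mult_delta_left)
    with mem[of "\<lambda>k. if k = i then 1 else 0"] show "a i \<in> ?I"
      by (simp add: one_mem zero_mem)
  qed
  ultimately show "Idl\<^bsub>ring_of\<^esub> (a ` {..<n}) \<subseteq> ?I"
    by (rule R.genideal_minimal)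
  have "a ` {..<n} \<subseteq> carrier ring_of" using a by auto
  then interpret I: ideal "Idl\<^bsub>ring_of\<^esub> (a ` {..<n})" ring_of
    by (rule R.genideal_ideal)
  have aI: "a i \<in> Idl\<^bsub>ring_of\<^esub> (a ` {..<n})" if "i < n" for i
    using R.genideal_self[of "a ` {..<n}"] a that by auto
  \<comment> \<open>Partial sums up to \<open>m\<close> are used for the induction; the coefficients
    stay indexed up to \<open>n\<close>.\<close>
  have "(\<Sum>i<m. r i * a i) \<in> Idl\<^bsub>ring_of\<^esub> (a ` {..<n})" if "\<forall>i<n. r i \<in> C" "m \<le> n" for r m
    using that(2)
  proof (induction m)
    case 0
    then show ?case using I.zero_closed by simp
  next
    case (Suc m)
    then show ?case
      using I.a_closed[OF _ I.I_l_closed[OF aI, of m "r m"]] that(1) by simp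
  qed
  then show "?I \<subseteq> Idl\<^bsub>ring_of\<^esub> (a ` {..<n})" by blast
qed

text \<open>The tuple and its generating relations already are a presentation; what has to be
  checked is that cutting vectors down to extensional functions changes nothing.\<close>

lemma finitely_presented_idealI:
  assumes a: "\<And>i. i < n \<Longrightarrow> a i \<in> C" and fg: "fg_relations C n a"
  shows "finitely_presented_ideal ring_of (Idl\<^bsub>ring_of\<^esub> (a ` {..<n}))"
proof -
  let ?I = "Idl\<^bsub>ring_of\<^esub> (a ` {..<n})"
  from fg obtain m :: nat and s where s: "\<forall>j<m. \<forall>i<n. s j i \<in> C" "\<forall>j<m. (\<Sum>i<n. s j i * a i) = 0"
    and gen: "\<forall>r. (\<forall>i<n. r i \<in> C) \<longrightarrow> (\<Sum>i<n. r i * a i) = 0 \<longrightarrow>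
       (\<exists>c. (\<forall>j<m. c j \<in> C) \<and> (\<forall>i<n. r i = (\<Sum>j<m. c j * s j i)))"
    by (rule fg_relationsE)
  let ?s = "\<lambda>j. restrict (s j) {..<n}"
  have lc: "lin_comb ring_of n a r = (\<Sum>i<n. r i * a i)" if "r \<in> {..<n} \<rightarrow>\<^sub>E C" for r
    using that a by (intro lin_comb_ring_of) auto
  have lc': "lin_comb ring_of m (\<lambda>j. ?s j i) c = (\<Sum>j<m. c j * s j i)"
    if "c \<in> {..<m} \<rightarrow>\<^sub>E C" "i < n" for c i
    using that s by (subst lin_comb_ring_of) auto
  have "a ` {..<n} \<subseteq> carrier ring_of" using a by auto
  then have I: "ideal ?I ring_of" by (rule R.genideal_ideal)
  have aI: "a \<in> {..<n} \<rightarrow> ?I"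
    using R.genideal_self[of "a ` {..<n}"] a by auto
  have s': "?s \<in> {..<m} \<rightarrow> ({..<n} \<rightarrow>\<^sub>E carrier ring_of)"
    using s by auto
  have im: "lin_comb ring_of n a ` ({..<n} \<rightarrow>\<^sub>E carrier ring_of) = ?I"
  proof -
    have "?I = (\<lambda>r. \<Sum>i<n. r i * a i) ` ({..<n} \<rightarrow>\<^sub>E C)"
    proof -
      have I: "?I = {\<Sum>i<n. r i * a i |r. \<forall>i<n. r i \<in> C}"
        by (rule genideal_image[OF a])
      have "(\<Sum>i<n. r i * a i) \<in> (\<lambda>r. \<Sum>i<n. r i * a i) ` ({..<n} \<rightarrow>\<^sub>E C)"
        if "\<forall>i<n. r i \<in> C" for r
        using that by (intro image_eqI[of _ _ "restrict r {..<n}"]) auto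
      then show ?thesis
        unfolding I by (auto simp: PiE_iff)
    qed
    also have "\<dots> = lin_comb ring_of n a ` ({..<n} \<rightarrow>\<^sub>E carrier ring_of)"
      by (rule image_cong) (simp_all add: lc)
    finally show ?thesis by simp
  qed
  have rel: "(\<lambda>c. \<lambda>i\<in>{..<n}. lin_comb ring_of m (\<lambda>j. ?s j i) c) `
      ({..<m} \<rightarrow>\<^sub>E carrier ring_of) = relations ring_of n a" (is "?F ` _ = _")
  proof (intro Set.set_eqI iffI)
    fix r assume "r \<in> ?F ` ({..<m} \<rightarrow>\<^sub>E carrier ring_of)"
    then obtain c where c: "c \<in> {..<m} \<rightarrow>\<^sub>E C" "r = ?F c" by auto
    have r: "r = (\<lambda>i\<in>{..<n}. \<Sum>j<m. c j * s j i)"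
      using c lc' by auto
    have mem: "r \<in> {..<n} \<rightarrow>\<^sub>E C"
      unfolding r using c(1) s(1) by (auto intro!: sum_mem mult_mem)
    have "(\<Sum>i<n. r i * a i) = (\<Sum>i<n. \<Sum>j<m. c j * (s j i * a i))"
      unfolding r by (simp add: sum_distrib_right mult.assoc)
    also have "\<dots> = (\<Sum>j<m. c j * (\<Sum>i<n. s j i * a i))"
      by (subst sum.swap) (simp add: sum_distrib_left)
    also have "\<dots> = 0" using s(2) by simp
    finally show "r \<in> relations ring_of n a"
      using mem by (simp add: relations_def lc)
  next
    fix r assume "r \<in> relations ring_of n a"
    then have r: "r \<in> {..<n} \<rightarrow>\<^sub>E C" "(\<Sum>i<n. r i * a i) = 0"
      using lc[of r] by (simp_all add: relations_def)
    have "\<forall>i<n. r i \<in> C" using PiE_mem[OF r(1)] by simp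
    then obtain c where c: "\<forall>j<m. c j \<in> C" "\<forall>i<n. r i = (\<Sum>j<m. c j * s j i)"
      using gen r(2) by blast
    let ?c = "restrict c {..<m}"
    have c': "?c \<in> {..<m} \<rightarrow>\<^sub>E C" using c by auto
    have "r i = ?F ?c i" for i
    proof (cases "i < n")
      case True
      with lc'[OF c' True] c(2) show ?thesis by simp
    next
      case False
      with PiE_arb[OF r(1), of i] show ?thesis by simp
    qed
    then have "r = ?F ?c" by (rule ext)
    then show "r \<in> ?F ` ({..<m} \<rightarrow>\<^sub>E carrier ring_of)"
      by (rule image_eqI[of r ?F ?c]) (use c' in simp)
  qed
  show ?thesis
    unfolding finitely_presented_ideal_def
    by (rule conjI[OF I], rule exI[of _ n], rule exI[of _ m], rule bexI[OF _ aI],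
        rule bexI[OF _ s'], rule conjI[OF im rel])
qed

text \<open>This is Schanuel's lemma made explicit. If \<open>a i = \<Sum>k. p i k * b k\<close>,
  \<open>b k = \<Sum>i. q k i * a i\<close> and the relations of \<open>a\<close> are generated by the
  rows of \<open>s\<close>, then those of \<open>b\<close> are generated by the rows of
  \<open>s p\<close> and \<open>1 - q p\<close>.\<close>

lemma fg_relations_if_finitely_presented_ideal:
  assumes b: "\<And>i. i < n \<Longrightarrow> b i \<in> C"
    and fp: "finitely_presented_ideal ring_of (Idl\<^bsub>ring_of\<^esub> (b ` {..<n}))"
  shows "fg_relations C n b"
proof -
  let ?I = "Idl\<^bsub>ring_of\<^esub> (b ` {..<n})"
  from fp obtain n' m a s where aI: "a \<in> {..<n'} \<rightarrow> ?I"
    and s: "s \<in> {..<m} \<rightarrow> ({..<n'} \<rightarrow>\<^sub>E C)"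
    and gen: "lin_comb ring_of n' a ` ({..<n'} \<rightarrow>\<^sub>E C) = ?I"
    and rel: "(\<lambda>c. \<lambda>i\<in>{..<n'}. lin_comb ring_of m (\<lambda>j. s j i) c) ` ({..<m} \<rightarrow>\<^sub>E C)
                = relations ring_of n' a"
    unfolding finitely_presented_ideal_def ring_of_simps by blast
  have "b ` {..<n} \<subseteq> carrier ring_of" using b by auto
  then have bI: "b k \<in> ?I" if "k < n" for k
    using R.genideal_self[of "b ` {..<n}"] that by auto
  have I: "?I = {\<Sum>i<n. r i * b i |r. \<forall>i<n. r i \<in> C}"
    by (rule genideal_image[OF b])
  have aC: "a i \<in> C" if "i < n'" for i
  proof -
    have "a i \<in> ?I" using aI that by auto
    then show ?thesis using b unfolding I by (auto intro!: sum_mem mult_mem)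
  qed
  have sC: "s j i \<in> C" if "j < m" "i < n'" for j i
    using s that by (auto simp: Pi_iff PiE_iff)
  \<comment> \<open>The tuples \<open>a\<close> and \<open>b\<close> generate the same ideal, so
    each is expressed through the other by matrices \<open>p\<close> and \<open>q\<close>.\<close>
  have "\<forall>i\<in>{..<n'}. \<exists>p. (\<forall>k<n. p k \<in> C) \<and> a i = (\<Sum>k<n. p k * b k)"
    using aI I by (auto simp: Pi_iff) blast
  then obtain p where p: "\<And>i k. i < n' \<Longrightarrow> k < n \<Longrightarrow> p i k \<in> C"
      "\<And>i. i < n' \<Longrightarrow> a i = (\<Sum>k<n. p i k * b k)"
    by (metis lessThan_iff)
  have "\<exists>q. (\<forall>i<n'. q i \<in> C) \<and> b k = (\<Sum>i<n'. q i * a i)" if k: "k < n" for k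
  proof -
    obtain q where q: "q \<in> {..<n'} \<rightarrow>\<^sub>E C" "b k = lin_comb ring_of n' a q"
      using bI[OF k] gen by blast
    then have "b k = (\<Sum>i<n'. q i * a i)"
      using aC by (subst (asm) lin_comb_ring_of) auto
    with q(1) show ?thesis by auto
  qed
  then obtain q where q: "\<And>i k. i < n' \<Longrightarrow> k < n \<Longrightarrow> q k i \<in> C"
      "\<And>k. k < n \<Longrightarrow> b k = (\<Sum>i<n'. q k i * a i)"
    by metis
  have rel_s: "(\<Sum>i<n'. s j i * a i) = 0" if j: "j < m" for j
  proof -
    \<comment> \<open>The \<open>j\<close>-th unit vector: its image under the presentation map is
      the row \<open>s j\<close>, which is therefore itself a relation.\<close>
    let ?c = "\<lambda>l\<in>{..<m}. if l = j then 1 else (0::'b)"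
    let ?r = "\<lambda>i\<in>{..<n'}. lin_comb ring_of m (\<lambda>j. s j i) ?c"
    have "?c \<in> {..<m} \<rightarrow>\<^sub>E C" by (auto simp: one_mem zero_mem)
    then have r: "?r \<in> relations ring_of n' a" using rel by blast
    have "lin_comb ring_of m (\<lambda>j. s j i) ?c = s j i" if "i < n'" for i
      using j sC that
      by (subst lin_comb_ring_of)
        (auto simp: one_mem zero_mem if_distrib[of "\<lambda>x. x * _"] cong: if_cong)
    then have "?r = (\<lambda>i\<in>{..<n'}. s j i)" by auto
    with r have "lin_comb ring_of n' a (\<lambda>i\<in>{..<n'}. s j i) = 0"
      by (simp add: relations_def)
    then show ?thesis using aC sC[OF j] by (subst (asm) lin_comb_ring_of) auto
  qed
  have rel_gen: "\<exists>c. (\<forall>j<m. c j \<in> C) \<and> (\<forall>i<n'. r i = (\<Sum>j<m. c j * s j i))"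
    if r: "\<And>i. i < n' \<Longrightarrow> r i \<in> C" "(\<Sum>i<n'. r i * a i) = 0" for r
  proof -
    have "restrict r {..<n'} \<in> relations ring_of n' a"
      using r aC by (auto simp: relations_def lin_comb_ring_of)
    then obtain c where c: "c \<in> {..<m} \<rightarrow>\<^sub>E C"
      "restrict r {..<n'} = (\<lambda>i\<in>{..<n'}. lin_comb ring_of m (\<lambda>j. s j i) c)"
      using rel by (metis (no_types, lifting) imageE)
    have "r i = (\<Sum>j<m. c j * s j i)" if i: "i < n'" for i
    proof -
      have "r i = lin_comb ring_of m (\<lambda>j. s j i) c"
        using fun_cong[OF c(2), of i] i by simp
      also have "\<dots> = (\<Sum>j<m. c j * s j i)"
        using c(1) sC i by (intro lin_comb_ring_of) auto
      finally show ?thesis .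
    qed
    with c(1) show ?thesis by auto
  qed
  let ?J = "Sum_Type.Plus {..<m} {..<n}"
  define t where "t = (\<lambda>x k. case x of Inl j \<Rightarrow> \<Sum>i<n'. s j i * p i k
    | Inr l \<Rightarrow> (if k = l then 1 else 0) - (\<Sum>i<n'. q l i * p i k))"
  have qpb: "(\<Sum>k<n. (\<Sum>i<n'. f i * p i k) * b k) = (\<Sum>i<n'. f i * a i)" for f
  proof -
    have "(\<Sum>k<n. (\<Sum>i<n'. f i * p i k) * b k) = (\<Sum>k<n. \<Sum>i<n'. f i * (p i k * b k))"
      by (simp add: sum_distrib_right mult.assoc)
    also have "\<dots> = (\<Sum>i<n'. f i * (\<Sum>k<n. p i k * b k))"
      by (subst sum.swap) (simp add: sum_distrib_left)
    finally show ?thesis using p(2) by simp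
  qed
  show ?thesis
  proof (rule fg_relationsI[where J = ?J and s = t])
    show "finite ?J" by simp
    show "t x k \<in> C" if "x \<in> ?J" "k < n" for x k
      using that by (auto simp: t_def sC p q
          intro!: sum_mem mult_mem diff_mem uminus_mem zero_mem one_mem)
    show "(\<Sum>k<n. t x k * b k) = 0" if x: "x \<in> ?J" for x
    proof (cases x)
      case (Inl j)
      with x show ?thesis by (auto simp: t_def qpb rel_s)
    next
      case (Inr l)
      with x show ?thesis
        by (auto simp: t_def qpb left_diff_distrib sum_subtractf q(2)[symmetric]
            if_distrib[of "\<lambda>x. x * _"] cong: if_cong)
    qed
    fix r assume r: "\<And>i. i < n \<Longrightarrow> r i \<in> C" "(\<Sum>i<n. r i * b i) = 0"
    \<comment> \<open>With r' = r q, a relation of \<open>a\<close>, one has r = r' p + r (1 - q p).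
      The first summand is a combination of the rows of s p, the second one of the rows of 1 - q
      p.\<close>
    define r' where "r' = (\<lambda>i. \<Sum>k<n. r k * q k i)"
    have r'C: "r' i \<in> C" if "i < n'" for i
      using that r q by (auto simp: r'_def intro!: sum_mem mult_mem)
    have "(\<Sum>i<n'. r' i * a i) = (\<Sum>i<n'. \<Sum>k<n. r k * (q k i * a i))"
      by (simp add: r'_def sum_distrib_right mult.assoc)
    also have "\<dots> = (\<Sum>k<n. r k * (\<Sum>i<n'. q k i * a i))"
      by (subst sum.swap) (simp add: sum_distrib_left)
    also have "\<dots> = 0" using r(2) q(2) by simp
    finally obtain c where c: "\<forall>j<m. c j \<in> C" "\<forall>i<n'. r' i = (\<Sum>j<m. c j * s j i)"
      using rel_gen r'C by blast
    have "r k = (\<Sum>x\<in>?J. case_sum c r x * t x k)" if k: "k < n" for k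
    proof -
      have "(\<Sum>l<n. r l * (\<Sum>i<n'. q l i * p i k)) = (\<Sum>l<n. \<Sum>i<n'. r l * q l i * p i k)"
        by (simp add: sum_distrib_left mult.assoc)
      also have "\<dots> = (\<Sum>i<n'. r' i * p i k)"
        by (subst sum.swap) (simp add: r'_def sum_distrib_right)
      finally have "(\<Sum>l<n. r l * t (Inr l) k) = r k - (\<Sum>i<n'. r' i * p i k)"
        using k by (simp add: t_def right_diff_distrib sum_subtractf
            if_distrib[of "\<lambda>x. _ * x"] cong: if_cong)
      moreover have "(\<Sum>j<m. c j * t (Inl j) k) = (\<Sum>j<m. \<Sum>i<n'. c j * s j i * p i k)"
        by (simp add: t_def sum_distrib_left mult.assoc)
      moreover have "\<dots> = (\<Sum>i<n'. r' i * p i k)"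
        by (subst sum.swap) (simp add: c(2) sum_distrib_right)
      ultimately show ?thesis
        by (simp add: sum.Plus)
    qed
    then show "\<exists>c. (\<forall>j\<in>?J. c j \<in> C) \<and>
        (\<forall>i<n. r i = (\<Sum>j\<in>?J. c j * t j i))"
      using c r by (intro exI[of _ "case_sum c r"]) auto
  qed
qed

text \<open>Schanuel's lemma allows the relations of the given pair to be tested, whatever tuple the
  presentation of its ideal uses.\<close>

lemma finite_conductor_ring_iff:
  "finite_conductor_ring ring_of \<longleftrightarrow> (\<forall>a. (\<forall>i<2. a i \<in> C) \<longrightarrow> fg_relations C 2 a)"
proof -
  have im: "a ` {..<2} = {a 0, a 1}" for a :: "nat \<Rightarrow> 'b"
    by (auto simp: lessThan_nat_numeral less_Suc_eq numeral_2_eq_2)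
  show ?thesis
  proof (intro iffI allI impI)
    fix a :: "nat \<Rightarrow> 'b" assume fc: "finite_conductor_ring ring_of" and a: "\<forall>i<2. a i \<in> C"
    then have "finitely_presented_ideal ring_of (Idl\<^bsub>ring_of\<^esub> (a ` {..<2}))"
      unfolding im finite_conductor_ring_def by simp
    with a show "fg_relations C 2 a"
      using fg_relations_if_finitely_presented_ideal by blast
  next
    assume fg: "\<forall>a. (\<forall>i<2. a i \<in> C) \<longrightarrow> fg_relations C 2 a"
    have "finitely_presented_ideal ring_of (Idl\<^bsub>ring_of\<^esub> {x, y})" if "x \<in> C" "y \<in> C" for x y
      using finitely_presented_idealI[of 2 "\<lambda>i. if i = 0 then x else y"] fg that
      unfolding im by simp
    then show "finite_conductor_ring ring_of"
      unfolding finite_conductor_ring_def using R.cring_axioms by simp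
  qed
qed

lemma coherent_ring_iff:
  "coherent_ring ring_of \<longleftrightarrow> (\<forall>n a. (\<forall>i<n. a i \<in> C) \<longrightarrow> fg_relations C n a)"
proof (intro iffI allI impI)
  fix n and a :: "nat \<Rightarrow> 'b" assume "coherent_ring ring_of" and a: "\<forall>i<n. a i \<in> C"
  then have "finitely_presented_ideal ring_of (Idl\<^bsub>ring_of\<^esub> (a ` {..<n}))"
    unfolding coherent_ring_def by auto
  with a show "fg_relations C n a"
    using fg_relations_if_finitely_presented_ideal by blast
next
  assume fg: "\<forall>n a. (\<forall>i<n. a i \<in> C) \<longrightarrow> fg_relations C n a"
  have "finitely_presented_ideal ring_of (Idl\<^bsub>ring_of\<^esub> S)" if S: "finite S" "S \<subseteq> C" for S
  proof -
    obtain a where a: "a ` {..<card S} = S"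
      using ex_bij_betw_nat_finite[OF S(1)] by (auto simp: bij_betw_def atLeast0LessThan)
    then have "\<forall>i<card S. a i \<in> C" using S(2) by blast
    then show ?thesis
      using finitely_presented_idealI[of "card S" a] fg unfolding a by blast
  qed
  then show "coherent_ring ring_of"
    unfolding coherent_ring_def using R.cring_axioms by simp
qed

end

section \<open>Denominators, interpolation and unimodular tuples\<close>

lemma sum_delta_mult:
  fixes f :: "nat \<Rightarrow> 'b::semiring_1"
  assumes "i < n"
  shows "(\<Sum>k<n. (if k = i then 1 else 0) * f k) = f i"
    and "(\<Sum>k<n. f k * (if i = k then 1 else 0)) = f i"
  using assms by (simp_all add: mult_delta_left mult_delta_right)

lemma common_denominator:
  fixes S :: "'a::idom fract set"
  assumes "finite S"
  obtains d where "d \<noteq> 0" "\<And>x. x \<in> S \<Longrightarrow> to_fract d * x \<in> range to_fract"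
proof -
  have "\<exists>d. d \<noteq> 0 \<and> (\<forall>x\<in>S. to_fract d * x \<in> range to_fract)"
    using assms
  proof (induction S rule: finite_induct)
    case empty
    show ?case by (intro exI[of _ 1]) simp
  next
    case (insert y S)
    then obtain d where d: "d \<noteq> 0" "\<forall>x\<in>S. to_fract d * x \<in> range to_fract" by blast
    obtain p q where pq: "y = to_fract p / to_fract q" "q \<noteq> 0"
      by (cases y) (auto simp: Fract_conv_to_fract)
    have "to_fract (q * d) * x \<in> range to_fract" if "x \<in> S" for x
      using range_to_fract_closed(2)[of "to_fract q" "to_fract d * x"] d(2) that
      by (simp add: mult.assoc)
    moreover have "to_fract (q * d) * y = to_fract (d * p)"
      using pq by simp
    then have "to_fract (q * d) * y \<in> range to_fract" by (metis rangeI)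
    ultimately show ?case
      using d(1) pq(2) by (intro exI[of _ "q * d"]) auto
  qed
  with that show thesis by blast
qed

text \<open>The product of the factors already split off does not vanish at a new root, so over a
  domain the root passes to the quotient.\<close>

lemma prod_linear_dvd:
  fixes p :: "'b::idom poly"
  assumes "finite A" "\<And>x. x \<in> A \<Longrightarrow> poly p x = 0"
  shows "(\<Prod>x\<in>A. [:- x, 1:]) dvd p"
  using assms
proof (induction A rule: finite_induct)
  case (insert x A)
  then obtain q where q: "p = (\<Prod>x\<in>A. [:- x, 1:]) * q"
    by auto
  have "poly (\<Prod>x\<in>A. [:- x, 1:]) x \<noteq> 0"
    using insert.hyps by (auto simp: poly_prod)
  with insert.prems[of x] q have "[:- x, 1:] dvd q"
    by (simp add: poly_eq_0_iff_dvd[symmetric])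
  then have "[:- x, 1:] * (\<Prod>x\<in>A. [:- x, 1:]) dvd q * (\<Prod>x\<in>A. [:- x, 1:])"
    by (intro mult_dvd_mono dvd_refl)
  then show ?case
    unfolding prod.insert[OF insert.hyps(1,2)] q by (simp only: mult.commute)
qed simp

text \<open>The Lagrange polynomial: the product over the other points, normalised at
  \<open>x\<close>.\<close>

lemma interpolation_basis:
  fixes x :: "'b::field"
  assumes "finite A"
  obtains l where "poly l x = 1" "\<And>y. y \<in> A \<Longrightarrow> y \<noteq> x \<Longrightarrow> poly l y = 0"
proof -
  define h where "h = (\<Prod>y\<in>A - {x}. [:- y, 1:])"
  have "poly h x \<noteq> 0" "\<And>y. y \<in> A \<Longrightarrow> y \<noteq> x \<Longrightarrow> poly h y = 0"
    using assms by (auto simp: h_def poly_prod)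
  then show thesis
    by (intro that[of "Polynomial.smult (inverse (poly h x)) h"]) auto
qed

text \<open>K[X] is a principal ideal domain: a nonzero element \<open>g\<close> of least degree in
  the ideal of the tuple divides every entry, since a nonzero remainder would have smaller degree.
  Cancelling \<open>g\<close> in its expression by the entries gives the Bezout identity.\<close>

lemma poly_unimodular_factorization:
  fixes a :: "nat \<Rightarrow> 'b::field poly"
  assumes "\<exists>i<n. a i \<noteq> 0"
  obtains g a' u where "g \<noteq> 0" "\<And>i. i < n \<Longrightarrow> a i = g * a' i" "(\<Sum>i<n. u i * a' i) = 1"
proof -
  define I where "I = {\<Sum>i<n. u i * a i |u. True}"
  have I: "(\<Sum>i<n. u i * a i) \<in> I" for u by (auto simp: I_def)
  have aI: "a i \<in> I" if "i < n" for i
    using I[of "\<lambda>k. if k = i then 1 else 0"] sum_delta_mult(1)[OF that, of a] by simp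
  obtain i where "i < n" "a i \<noteq> 0" using assms by blast
  then have "\<exists>h. h \<in> I \<and> h \<noteq> 0" using aI by blast
  then obtain g where g: "g \<in> I" "g \<noteq> 0" "\<And>h. h \<in> I \<Longrightarrow> h \<noteq> 0 \<Longrightarrow> degree g \<le> degree h"
    using ex_has_least_nat[of "\<lambda>h. h \<in> I \<and> h \<noteq> 0" _ degree] by blast
  then obtain u where u: "g = (\<Sum>i<n. u i * a i)" by (auto simp: I_def)
  have dvd: "g dvd a i" if i: "i < n" for i
  proof (rule ccontr)
    assume "\<not> g dvd a i"
    then have nz: "a i mod g \<noteq> 0" by (simp add: dvd_eq_mod_eq_0)
    have "a i mod g = a i - a i div g * g"
      by (simp add: minus_div_mult_eq_mod)
    also have "\<dots> = (\<Sum>k<n. ((if k = i then 1 else 0) - a i div g * u k) * a k)"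
      unfolding u left_diff_distrib sum_subtractf sum_delta_mult(1)[OF i]
      by (simp add: sum_distrib_left mult.assoc)
    finally have "a i mod g \<in> I" using I by simp
    from g(3)[OF this nz] degree_mod_less'[OF g(2) nz] show False by simp
  qed
  then have a: "a i = g * (a i div g)" if "i < n" for i using that by simp
  have "g * (\<Sum>i<n. u i * (a i div g)) = (\<Sum>i<n. u i * (g * (a i div g)))"
    by (simp add: sum_distrib_left mult.left_commute)
  also have "\<dots> = (\<Sum>i<n. u i * a i)"
    by (intro sum.cong refl) (metis a lessThan_iff)
  also have "\<dots> = g * 1" using u by simp
  finally have "(\<Sum>i<n. u i * (a i div g)) = 1"
    using g(2) mult_cancel_left by blast
  with g(2) a show thesis by (intro that[of g "\<lambda>i. a i div g" u])
qed

section \<open>Transfer of relations between D and Int(E,D)\<close>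

lemma type_subring_UNIV: "type_subring UNIV"
  by unfold_locales auto

lemma type_subring_int_valued_polys: "type_subring (int_valued_polys E)"
proof
  show "1 \<in> int_valued_polys E"
    by (auto simp: int_valued_polys_def intro!: range_eqI[where x = 1])
qed (simp_all add: int_valued_polys_def range_to_fract_closed)

text \<open>Evaluation at \<open>e\<close> is a retraction of Int(E,D) onto the constants from D. A
  relation over D is lifted to constants, expanded there and evaluated at \<open>e\<close>.\<close>

lemma fg_relations_UNIV_if_int_valued_polys:
  fixes E :: "'a::idom set" and a :: "nat \<Rightarrow> 'a"
  assumes e: "e \<in> E"
    and fg: "fg_relations (int_valued_polys E) n (\<lambda>i. [:to_fract (a i):])"
  shows "fg_relations UNIV n a"
proof -
  from fg obtain m :: nat and s where
    s: "\<forall>j<m. \<forall>i<n. s j i \<in> int_valued_polys E"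
      "\<forall>j<m. (\<Sum>i<n. s j i * [:to_fract (a i):]) = 0"
    and gen: "\<forall>r. (\<forall>i<n. r i \<in> int_valued_polys E) \<longrightarrow> (\<Sum>i<n. r i * [:to_fract (a i):]) = 0 \<longrightarrow>
       (\<exists>c. (\<forall>j<m. c j \<in> int_valued_polys E) \<and> (\<forall>i<n. r i = (\<Sum>j<m. c j * s j i)))"
    by (rule fg_relationsE)
  \<comment> \<open>Evaluation at \<open>e\<close>, with its value pulled back from K to D.\<close>
  define ev where "ev = (\<lambda>p. inv_into UNIV to_fract (poly p (to_fract e)))"
  have ev: "to_fract (ev p) = poly p (to_fract e)" if "p \<in> int_valued_polys E" for p
    unfolding ev_def using that e by (intro f_inv_into_f) (auto simp: int_valued_polys_def)
  show ?thesis
  proof (rule fg_relationsI[where J = "{..<m}" and s = "\<lambda>j i. ev (s j i)"])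
    fix j assume j: "j \<in> {..<m}"
    have "to_fract (\<Sum>i<n. ev (s j i) * a i) = poly (\<Sum>i<n. s j i * [:to_fract (a i):]) (to_fract e)"
      using s(1) j by (simp add: poly_sum ev mult.commute)
    also have "\<dots> = 0" using s(2) j by simp
    finally show "(\<Sum>i<n. ev (s j i) * a i) = 0" by (simp only: to_fract_eq_0_iff)
  next
    fix r assume r: "(\<Sum>i<n. r i * a i) = 0"
    have "(\<Sum>i<n. [:to_fract (r i):] * [:to_fract (a i):]) = [:to_fract (\<Sum>i<n. r i * a i):]"
      by (simp add: sum_to_poly mult.commute)
    also have "\<dots> = 0" using r by simp
    finally obtain c where c: "\<forall>j<m. c j \<in> int_valued_polys E"
      "\<forall>i<n. [:to_fract (r i):] = (\<Sum>j<m. c j * s j i)"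
      using gen[rule_format, of "\<lambda>i. [:to_fract (r i):]"] by (auto simp: int_valued_polys_def)
    have "r i = (\<Sum>j<m. ev (c j) * ev (s j i))" if i: "i < n" for i
    proof -
      have "to_fract (r i) = poly [:to_fract (r i):] (to_fract e)" by simp
      also have "\<dots> = to_fract (\<Sum>j<m. ev (c j) * ev (s j i))"
        using c i s(1) by (simp add: poly_sum ev)
      finally show ?thesis by (simp only: to_fract_eq_iff)
    qed
    then show "\<exists>c. (\<forall>j\<in>{..<m}. c j \<in> UNIV) \<and> (\<forall>i<n. r i = (\<Sum>j\<in>{..<m}. c j * ev (s j i)))"
      by (intro exI[of _ "\<lambda>j. ev (c j)"]) simp
  qed simp_all
qed

text \<open>Dividing by the gcd over the field makes the tuple \<open>a\<close> unimodular, so that its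
  relations over \<open>K[X]\<close> form the image of the projection \<open>r \<mapsto> r - (\<Sum>k. r k * a' k) * u\<close>,
  spanned by the vectors \<open>\<nu> k\<close>. The relations of the values of \<open>a'\<close> at a point
  of \<open>E\<close> then lift to relations of \<open>a\<close> vanishing at the other points. A relation
  vanishing on all of \<open>E\<close> is a multiple of \<open>f = \<Prod>e\<in>E. X - e\<close>, and its
  coefficients with respect to the \<open>\<nu> k\<close> are integer-valued because they are multiples
  of \<open>f\<close>.\<close>

lemma fg_relations_int_valued_polys:
  fixes E :: "'a::idom set"
  assumes E: "finite E"
    and a: "\<And>i. i < n \<Longrightarrow> a i \<in> int_valued_polys E"
    and fg: "\<And>b :: nat \<Rightarrow> 'a. fg_relations UNIV n b"
  shows "fg_relations (int_valued_polys E) n a"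
proof -
  interpret B: type_subring "int_valued_polys E"
    by (rule type_subring_int_valued_polys)
  show ?thesis
  proof (cases "\<exists>i<n. a i \<noteq> 0")
    \<comment> \<open>Every vector is a relation of the zero tuple, so the unit vectors
      generate.\<close>
    case False
    show ?thesis
    proof (rule fg_relationsI[where J = "{..<n}" and s = "\<lambda>j i. if i = j then 1 else 0"])
      fix r assume r: "\<And>i. i < n \<Longrightarrow> r i \<in> int_valued_polys E"
      then show "\<exists>c. (\<forall>j\<in>{..<n}. c j \<in> int_valued_polys E) \<and>
          (\<forall>i<n. r i = (\<Sum>j\<in>{..<n}. c j * (if i = j then 1 else 0)))"
        by (intro exI[of _ r]) (simp add: sum_delta_mult(2))
    qed (use False in \<open>auto simp: B.one_mem B.zero_mem\<close>)
  next
    case True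
    then obtain g a' u where g: "g \<noteq> 0" and a': "\<And>i. i < n \<Longrightarrow> a i = g * a' i"
      and u: "(\<Sum>i<n. u i * a' i) = 1"
      by (rule poly_unimodular_factorization) blast
    have rel_iff: "(\<Sum>i<n. r i * a i) = 0 \<longleftrightarrow> (\<Sum>i<n. r i * a' i) = 0" for r
    proof -
      have "(\<Sum>i<n. r i * a i) = g * (\<Sum>i<n. r i * a' i)"
        using a' by (simp add: sum_distrib_left mult.left_commute)
      with g show ?thesis by simp
    qed
    \<comment> \<open>By the Bezout identity, subtracting \<open>W\<close> times \<open>u\<close>
      turns any vector \<open>w\<close> into a relation of \<open>a'\<close>.\<close>
    have proj: "(\<Sum>i<n. (w i - W * u i) * a' i) = 0" if "W = (\<Sum>k<n. w k * a' k)" for w W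
    proof -
      have "(\<Sum>i<n. (w i - W * u i) * a' i) = (\<Sum>i<n. w i * a' i) - W * (\<Sum>i<n. u i * a' i)"
        by (simp add: left_diff_distrib sum_subtractf sum_distrib_left mult.assoc)
      with that u show ?thesis by simp
    qed

    \<comment> \<open>The values of \<open>a'\<close> on E lie only in K. Scaling them by a common
      denominator \<open>d\<close> gives tuples \<open>b e\<close> over D with the same
      relations.\<close>
    have "finite ((\<lambda>(i, e). poly (a' i) (to_fract e)) ` ({..<n} \<times> E))" using E by simp
    then obtain d where d: "d \<noteq> 0"
      and dr: "\<And>x. x \<in> (\<lambda>(i, e). poly (a' i) (to_fract e)) ` ({..<n} \<times> E) \<Longrightarrow>
        to_fract d * x \<in> range to_fract"
      by (rule common_denominator) blast
    define b where "b e i = inv_into UNIV to_fract (to_fract d * poly (a' i) (to_fract e))" for e i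
    have b: "to_fract (b e i) = to_fract d * poly (a' i) (to_fract e)" if "e \<in> E" "i < n" for e i
      unfolding b_def using that by (intro f_inv_into_f dr) force
    have rel_b: "(\<Sum>i<n. r i * b e i) = 0 \<longleftrightarrow>
        (\<Sum>i<n. to_fract (r i) * poly (a' i) (to_fract e)) = 0" if "e \<in> E" for e r
    proof -
      have "(\<Sum>i<n. r i * b e i) = 0 \<longleftrightarrow> to_fract (\<Sum>i<n. r i * b e i) = 0"
        by (rule to_fract_eq_0_iff[symmetric])
      also have "to_fract (\<Sum>i<n. r i * b e i) =
          to_fract d * (\<Sum>i<n. to_fract (r i) * poly (a' i) (to_fract e))"
        using that by (simp add: b sum_distrib_left mult.left_commute)
      finally show ?thesis using d by simp
    qed
    \<comment> \<open>Bundles the finite generation at one point so that \<open>m\<close> and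
      \<open>s\<close> can be chosen for all points at once.\<close>
    define gens where "gens e m s \<longleftrightarrow> (\<forall>j<m. (\<Sum>i<n. s j i * b e i) = 0) \<and>
        (\<forall>r. (\<Sum>i<n. r i * b e i) = 0 \<longrightarrow> (\<exists>c. \<forall>i<n. r i = (\<Sum>j<m. c j * s j i)))"
      for e and m :: nat and s
    have "\<exists>m s. gens e m s" for e
      using fg[of "b e"] unfolding fg_relations_def gens_def by simp
    then obtain m s where gens: "\<And>e. gens e (m e) (s e)"
      by metis
    have s: "(\<Sum>i<n. s e j i * b e i) = 0" if "j < m e" for e j
      using gens[of e] that by (simp add: gens_def)
    have gen: "\<exists>c. \<forall>i<n. r i = (\<Sum>j<m e. c j * s e j i)"
      if "(\<Sum>i<n. r i * b e i) = 0" for e r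
      using gens[of e] that by (simp add: gens_def)

    have "\<exists>l. poly l (to_fract e) = 1 \<and> (\<forall>x\<in>E. x \<noteq> e \<longrightarrow> poly l (to_fract x) = 0)" for e
    proof -
      obtain l where "poly l (to_fract e) = 1"
        "\<And>y. y \<in> to_fract ` E \<Longrightarrow> y \<noteq> to_fract e \<Longrightarrow> poly l y = 0"
        using interpolation_basis[of "to_fract ` E" "to_fract e"] E by blast
      then show ?thesis by (intro exI[of _ l]) simp
    qed
    then obtain l where l': "\<And>e. poly (l e) (to_fract e) = 1 \<and>
        (\<forall>x\<in>E. x \<noteq> e \<longrightarrow> poly (l e) (to_fract x) = 0)"
      by metis
    then have l: "poly (l e) (to_fract e) = 1"
      "x \<in> E \<Longrightarrow> x \<noteq> e \<Longrightarrow> poly (l e) (to_fract x) = 0" for e x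
      by simp_all
    \<comment> \<open>Interpolation lifts the relation \<open>s e j\<close> to a vector with value
      \<open>s e j\<close> at \<open>e\<close> and 0 elsewhere on E. Projecting it gives the
      relation \<open>L e j\<close>; since \<open>W e j\<close> vanishes on E, the values there are
      unchanged.\<close>
    define w where "w e j i = Polynomial.smult (to_fract (s e j i)) (l e)" for e j i
    define W where "W e j = (\<Sum>k<n. w e j k * a' k)" for e j
    define L where "L e j i = w e j i - W e j * u i" for e j i
    have W: "poly (W e j) (to_fract x) = 0" if "x \<in> E" "j < m e" for e j x
    proof (cases "x = e")
      case True
      have "(\<Sum>i<n. to_fract (s e j i) * poly (a' i) (to_fract e)) = 0"
        using rel_b[of e "s e j"] s[of j e] that True by simp
      with True show ?thesis by (simp add: W_def w_def poly_sum l)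
    next
      case False
      with that show ?thesis by (simp add: W_def w_def poly_sum l)
    qed
    have L: "poly (L e j i) (to_fract x) = (if x = e then to_fract (s e j i) else 0)"
      if "x \<in> E" "j < m e" for e j i x
      using that by (auto simp: L_def W w_def l)

    \<comment> \<open>The projections of the unit vectors, which span all relations over K[X]. The
      factor \<open>d'\<close> makes them integer-valued.\<close>
    define \<nu> where "\<nu> k i = (if i = k then 1 else 0) - a' k * u i" for k i
    have "finite ((\<lambda>(k, i, e). poly (\<nu> k i) (to_fract e)) ` ({..<n} \<times> {..<n} \<times> E))"
      using E by simp
    then obtain d' where d': "d' \<noteq> 0"
      and "\<And>x. x \<in> (\<lambda>(k, i, e). poly (\<nu> k i) (to_fract e)) ` ({..<n} \<times> {..<n} \<times> E) \<Longrightarrow>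
        to_fract d' * x \<in> range to_fract"
      by (rule common_denominator) blast
    then have \<nu>: "to_fract d' * poly (\<nu> k i) (to_fract e) \<in> range to_fract"
      if "k < n" "i < n" "e \<in> E" for k i e
      using that by force

    define P where "P = Sigma E (\<lambda>e. {..<m e})"
    define T where "T x i = (case x of Inl (e, j) \<Rightarrow> L e j i
        | Inr k \<Rightarrow> [:to_fract d':] * \<nu> k i)"
      for x i
    let ?J = "Sum_Type.Plus P {..<n}"
    have P: "finite P" using E by (simp add: P_def)
    show ?thesis
    proof (rule fg_relationsI[where J = ?J and s = T])
      show "finite ?J" using P by simp
      show "T x i \<in> int_valued_polys E" if "x \<in> ?J" "i < n" for x i
      proof (cases x)
        case (Inl p)
        with that show ?thesis
          by (auto simp: T_def P_def int_valued_polys_def L intro: range_eqI[where x = 0])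
      next
        case (Inr k)
        with that show ?thesis
          by (auto simp: T_def int_valued_polys_def intro!: \<nu>)
      qed
      show "(\<Sum>i<n. T x i * a i) = 0" if x: "x \<in> ?J" for x
        unfolding rel_iff
      proof (cases x)
        case (Inl p)
        obtain e j where "p = (e, j)" by force
        with Inl show "(\<Sum>i<n. T x i * a' i) = 0"
          using proj[OF W_def] by (simp add: T_def L_def)
      next
        case (Inr k)
        with x have k: "k < n" by auto
        have "(\<Sum>i<n. \<nu> k i * a' i) = 0"
          unfolding \<nu>_def using sum_delta_mult(1)[OF k, of a'] by (intro proj) simp
        moreover have "(\<Sum>i<n. T x i * a' i) = [:to_fract d':] * (\<Sum>i<n. \<nu> k i * a' i)"
          by (simp only: Inr T_def sum.case sum_distrib_left mult.assoc)
        ultimately show "(\<Sum>i<n. T x i * a' i) = 0"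
          by simp
      qed
      fix r assume rB: "\<And>i. i < n \<Longrightarrow> r i \<in> int_valued_polys E" and r0: "(\<Sum>i<n. r i * a i) = 0"
      from r0 have r: "(\<Sum>i<n. r i * a' i) = 0" by (simp add: rel_iff)
      define \<rho> where "\<rho> e i = inv_into UNIV to_fract (poly (r i) (to_fract e))" for e i
      have \<rho>: "to_fract (\<rho> e i) = poly (r i) (to_fract e)" if "e \<in> E" "i < n" for e i
        unfolding \<rho>_def using rB that by (intro f_inv_into_f) (auto simp: int_valued_polys_def)
      have "\<exists>c. \<forall>i<n. \<rho> e i = (\<Sum>j<m e. c j * s e j i)" if e: "e \<in> E" for e
      proof (rule gen)
        have "(\<Sum>i<n. to_fract (\<rho> e i) * poly (a' i) (to_fract e)) =
            poly (\<Sum>i<n. r i * a' i) (to_fract e)"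
          using e by (simp add: \<rho> poly_sum)
        then show "(\<Sum>i<n. \<rho> e i * b e i) = 0"
          using rel_b[OF e] r by simp
      qed
      then obtain c where c: "\<And>e i. e \<in> E \<Longrightarrow> i < n \<Longrightarrow> \<rho> e i = (\<Sum>j<m e. c e j * s e j i)"
        by metis
      \<comment> \<open>A combination of the lifts having the same values as \<open>r\<close> on
        E.\<close>
      define R where "R i = (\<Sum>(e, j)\<in>P. [:to_fract (c e j):] * L e j i)" for i
      have R: "poly (R i) (to_fract x) = poly (r i) (to_fract x)" if x: "x \<in> E" "i < n" for x i
      proof -
        have "poly (R i) (to_fract x) =
            (\<Sum>(e, j)\<in>P. if e = x then to_fract (c e j * s e j i) else 0)"
          unfolding R_def poly_sum using x by (intro sum.cong) (auto simp: P_def L)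
        also have "\<dots> = (\<Sum>e\<in>E. \<Sum>j<m e. if e = x then to_fract (c e j * s e j i) else 0)"
          unfolding P_def using E by (subst sum.Sigma) auto
        also have "\<dots> = (\<Sum>e\<in>E. if e = x then \<Sum>j<m e. to_fract (c e j * s e j i) else 0)"
          by (intro sum.cong) auto
        also have "\<dots> = to_fract (\<Sum>j<m x. c x j * s x j i)"
          using E x by simp
        also have "\<dots> = poly (r i) (to_fract x)"
          using c[OF x] \<rho>[OF x] by simp
        finally show ?thesis .
      qed
      define f where "f = (\<Prod>x\<in>to_fract ` E. [:- x, 1:])"
      have f0: "f \<noteq> 0" using E by (simp add: f_def)
      \<comment> \<open>The difference vanishes on E, so it is f times a vector \<open>t\<close>; as
        \<open>r\<close> and \<open>R\<close> are relations and f is nonzero, \<open>t\<close> is a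
        relation over K[X].\<close>
      have "\<forall>i\<in>{..<n}. \<exists>q. r i - R i = f * q"
        unfolding f_def using E R by (auto intro!: prod_linear_dvd simp: dvd_def[symmetric])
      then obtain t where t: "\<And>i. i < n \<Longrightarrow> r i - R i = f * t i"
        by (metis lessThan_iff)
      have "(\<Sum>i<n. R i * a' i) = (\<Sum>(e, j)\<in>P. [:to_fract (c e j):] * (\<Sum>i<n. L e j i * a' i))"
        unfolding R_def sum_distrib_right
        by (subst sum.swap) (simp add: sum_distrib_left mult.assoc case_prod_beta)
      also have "\<dots> = 0"
        using proj[OF W_def] by (simp add: L_def)
      finally have "(\<Sum>i<n. (r i - R i) * a' i) = 0"
        using r by (simp add: left_diff_distrib sum_subtractf)
      then have "f * (\<Sum>i<n. t i * a' i) = 0"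
        using t by (simp add: sum_distrib_left mult.assoc)
      with f0 have t0: "(\<Sum>i<n. t i * a' i) = 0" by simp
      \<comment> \<open>The coefficient undoing the factor \<open>d'\<close>. It is integer-valued
        despite the division because f makes it vanish on E.\<close>
      define q where "q k = Polynomial.smult (inverse (to_fract d')) (f * t k)" for k
      have q: "q k \<in> int_valued_polys E" for k
        using E by (auto simp: int_valued_polys_def q_def f_def poly_prod
            intro!: range_eqI[where x = 0])
      have "r i = (\<Sum>x\<in>?J. case_sum (\<lambda>(e, j). [:to_fract (c e j):]) q x * T x i)" if i: "i < n" for i
      proof -
        have "(\<Sum>k<n. q k * T (Inr k) i) = (\<Sum>k<n. f * (t k * \<nu> k i))"
          using d' by (simp add: q_def T_def mult.assoc)
        \<comment> \<open>The projection fixes the relation \<open>t\<close>: its correction term is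
          a multiple of \<Sum>k. t k * a' k, which is 0.\<close>
        also have "\<dots> = f * ((\<Sum>k<n. t k * (if i = k then 1 else 0)) - (\<Sum>k<n. t k * a' k) * u i)"
          by (simp add: \<nu>_def right_diff_distrib sum_subtractf sum_distrib_left sum_distrib_right
              mult.assoc)
        also have "\<dots> = r i - R i"
          unfolding sum_delta_mult(2)[OF i] t0 using t[OF i] by simp
        finally have "(\<Sum>k<n. q k * T (Inr k) i) = r i - R i" .
        moreover have "(\<Sum>p\<in>P. (case p of (e, j) \<Rightarrow> [:to_fract (c e j):]) * T (Inl p) i) = R i"
          unfolding R_def by (intro sum.cong) (auto simp: T_def)
        ultimately show ?thesis
          using P by (simp add: sum.Plus)
      qed
      moreover have "case_sum (\<lambda>(e, j). [:to_fract (c e j):]) q x \<in> int_valued_polys E" for x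
        using q by (auto simp: int_valued_polys_def split: sum.split)
      ultimately show "\<exists>c. (\<forall>j\<in>?J. c j \<in> int_valued_polys E) \<and> (\<forall>i<n. r i = (\<Sum>j\<in>?J. c j * T j i))"
        by (intro exI[of _ "case_sum (\<lambda>(e, j). [:to_fract (c e j):]) q"]) auto
    qed
  qed
qed

theorem corollary4p14:
  fixes E :: "'a::idom set"
  assumes "finite E" and "E \<noteq> {}"
  shows "(finite_conductor_ring (int_valued_ring E) \<longleftrightarrow>
            finite_conductor_ring (ring_of_type_algebra :: 'a ring)) \<and>
         (coherent_ring (int_valued_ring E) \<longleftrightarrow>
            coherent_ring (ring_of_type_algebra :: 'a ring))"
proof -
  interpret D: type_subring "UNIV :: 'a set" by (rule type_subring_UNIV)
  interpret B: type_subring "int_valued_polys E" by (rule type_subring_int_valued_polys)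
  have D: "D.ring_of = ring_of_type_algebra"
    by (simp add: ring_of_type_algebra_def)
  \<comment> \<open>The length \<open>n\<close> is kept fixed, so that this equivalence yields the
    finite conductor claim at 2 and the coherence claim over all \<open>n\<close>.\<close>
  have eq: "(\<forall>a. (\<forall>i<n. a i \<in> int_valued_polys E) \<longrightarrow> fg_relations (int_valued_polys E) n a) \<longleftrightarrow>
      (\<forall>a :: nat \<Rightarrow> 'a. fg_relations UNIV n a)" (is "?B \<longleftrightarrow> ?D") for n
  proof
    assume B: ?B
    obtain e where e: "e \<in> E" using \<open>E \<noteq> {}\<close> by blast
    show ?D
    proof
      fix a :: "nat \<Rightarrow> 'a"
      have "\<forall>i<n. [:to_fract (a i):] \<in> int_valued_polys E"
        by (simp add: int_valued_polys_def)
      then have "fg_relations (int_valued_polys E) n (\<lambda>i. [:to_fract (a i):])"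
        by (rule mp[OF spec[OF B, of "\<lambda>i. [:to_fract (a i):]"]])
      with e show "fg_relations UNIV n a" by (rule fg_relations_UNIV_if_int_valued_polys)
    qed
  next
    assume D: ?D
    show ?B
    proof (intro allI impI)
      fix a assume a: "\<forall>i<n. a i \<in> int_valued_polys E"
      show "fg_relations (int_valued_polys E) n a"
        by (rule fg_relations_int_valued_polys[OF \<open>finite E\<close> _ spec[OF D]]) (use a in simp)
    qed
  qed
  have fcD: "finite_conductor_ring (ring_of_type_algebra :: 'a ring) \<longleftrightarrow>
      (\<forall>a :: nat \<Rightarrow> 'a. fg_relations UNIV 2 a)"
    using D.finite_conductor_ring_iff unfolding D by simp
  have cohD: "coherent_ring (ring_of_type_algebra :: 'a ring) \<longleftrightarrow>
      (\<forall>n (a :: nat \<Rightarrow> 'a). fg_relations UNIV n a)"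
    using D.coherent_ring_iff unfolding D by simp
  show ?thesis
    unfolding int_valued_ring_def B.finite_conductor_ring_iff B.coherent_ring_iff fcD cohD
    by (intro conjI eq all_cong1)
qed

end
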